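(* Let $f:\mathbb{R}^n\to\mathbb{R}$ be continuously differentiable with $L$-Lipschitz continuous gradient for some $L>0$, and suppose that there exists $f_{\mathrm{low}}\in\mathbb{R}$ such that $f(x)\ge f_{\mathrm{low}}$ for every $x\in\mathbb{R}^n$. Let $\epsilon\in(0,1)$, and consider the nonlinear conjugate gradient method with modified restart condition (described in the context) applied to $f$ from $x_0\in\mathbb{R}^n$, with parameters $\eta\in(0,1)$, $\theta\in(0,1)$, $\sigma\in(0,1]$, $\kappa\ge 1$, $p\ge 0$, $q\ge 0$. Suppose that $1+p-q\ge 0$. Then the number of iterations (and objective gradient evaluations) required by the method to reach a point $x_k$ satisfying $\|\nabla f(x_k)\|\le\epsilon$ is at most $$K_\epsilon:=\left\lfloor \frac{f(x_0)-f_{\mathrm{low}}}{c_{\mathcal{R}}}\,\epsilon^{-2}+\frac{f(x_0)-f_{\mathrm{low}}}{c_{\mathcal{N}}}\,\epsilon^{-\max\{1+p,\,2(1+p-q)\}}\right\rfloor,$$ where $$c_{\mathcal{R}}:=\eta\min\left\{1,\frac{2(1-\eta)\theta}{L}\right\},\qquad c_{\mathcal{N}}:=\eta\sigma\min\left\{1,\frac{2(1-\eta)\sigma\theta}{\kappa^2L}\right\}.$$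
   Context: $\|\cdot\|$ is the Euclidean norm on $\mathbb{R}^n$. Nonlinear conjugate gradient method with modified restart condition. Inputs: $x_0\in\mathbb{R}^n$, $\eta\in(0,1)$, $\theta\in(0,1)$, $\sigma\in(0,1]$, $\kappa\ge1$, $p\ge0$, $q\ge0$. Set $g_0=\nabla f(x_0)$ and $d_0=-g_0$. For $k=0,1,2,\dots$: 1. Compute $\alpha_k=\theta^{j_k}$, where $j_k$ is the smallest nonnegative integer such that $f(x_k+\alpha_kd_k)<f(x_k)+\eta\,\alpha_k\,g_k^{T}d_k$ (backtracking Armijo line search). 2. Set $x_{k+1}=x_k+\alpha_kd_k$ and $g_{k+1}=\nabla f(x_{k+1})$. 3. Choose a conjugate direction parameter $\beta_{k+1}\in\mathbb{R}$ (any choice is allowed). 4. Set $d_{k+1}=-g_{k+1}+\beta_{k+1}d_k$. 5. If $g_{k+1}^{T}d_{k+1}\ge-\sigma\|g_{k+1}\|^{1+p}$ or $\|d_{k+1}\|\ge\kappa\|g_{k+1}\|^{q}$, restart by resetting $d_{k+1}=-g_{k+1}$. The number of iterations required to reach a point satisfying $\|\nabla f(x_k)\|\le\epsilon$ is the smallest index $K$ such that $\|\nabla f(x_K)\|\le\epsilon$; only the iterations prior to reaching such a point matter. Gradient evaluations are counted as one per iteration (iteration $k$ evaluates the new gradient $g_{k+1}$). *)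

theory Defs
  imports "HOL-Analysis.Analysis"
begin

text \<open>
  The gradient enters as a function \<open>G\<close> with \<open>GDERIV f x :> G x\<close> for every \<open>x\<close>.
  The field \<open>evals\<close> counts the gradients evaluated in the iterations done so far: iteration
  \<open>k\<close> evaluates only the gradient at its new point, and the initial gradient is not counted.
\<close>

record 'a ncg_state =
  point :: 'a
  grad :: 'a
  dir :: 'a
  evals :: nat

definition armijo ::
  "('a::real_inner \<Rightarrow> real) \<Rightarrow> real \<Rightarrow> 'a ncg_state \<Rightarrow> real \<Rightarrow> bool" where
  "armijo f \<eta> s \<alpha> \<longleftrightarrow>
     f (point s + \<alpha> *\<^sub>R dir s) < f (point s) + \<eta> * \<alpha> * (grad s \<bullet> dir s)"

text \<open>This is the step size only if some power of \<open>\<theta>\<close> satisfies the Armijo condition.\<close>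

definition backtrack ::
  "('a::real_inner \<Rightarrow> real) \<Rightarrow> real \<Rightarrow> real \<Rightarrow> 'a ncg_state \<Rightarrow> real" where
  "backtrack f \<eta> \<theta> s = \<theta> ^ (LEAST j. armijo f \<eta> s (\<theta> ^ j))"

text \<open>
  Since \<open>0 powr a = 0\<close> even for \<open>a = 0\<close>, the restart test is not meant to be read at a
  zero gradient. Such a point already meets every positive tolerance.
\<close>

definition restart ::
  "real \<Rightarrow> real \<Rightarrow> real \<Rightarrow> real \<Rightarrow> 'a::real_inner \<Rightarrow> 'a \<Rightarrow> bool" where
  "restart \<sigma> \<kappa> p q g d \<longleftrightarrow>
     g \<bullet> d \<ge> - \<sigma> * norm g powr (1 + p) \<or> norm d \<ge> \<kappa> * norm g powr q"

definition ncg_step ::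
  "('a::real_inner \<Rightarrow> real) \<Rightarrow> ('a \<Rightarrow> 'a) \<Rightarrow> real \<Rightarrow> real \<Rightarrow> real \<Rightarrow> real \<Rightarrow> real \<Rightarrow> real \<Rightarrow>
   real \<Rightarrow> 'a ncg_state \<Rightarrow> 'a ncg_state" where
  "ncg_step f G \<eta> \<theta> \<sigma> \<kappa> p q \<beta> s =
     (let x = point s + backtrack f \<eta> \<theta> s *\<^sub>R dir s;
          g = G x;
          d = - g + \<beta> *\<^sub>R dir s
      in \<lparr>point = x, grad = g, dir = (if restart \<sigma> \<kappa> p q g d then - g else d),
          evals = evals s + 1\<rparr>)"

text \<open>
  The free choice of the conjugate direction parameters is the sequence \<open>\<beta>\<close>; \<open>\<beta> 0\<close> is unused.
\<close>

primrec ncg ::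
  "('a::real_inner \<Rightarrow> real) \<Rightarrow> ('a \<Rightarrow> 'a) \<Rightarrow> real \<Rightarrow> real \<Rightarrow> real \<Rightarrow> real \<Rightarrow> real \<Rightarrow> real \<Rightarrow>
   'a \<Rightarrow> (nat \<Rightarrow> real) \<Rightarrow> nat \<Rightarrow> 'a ncg_state" where
  "ncg f G \<eta> \<theta> \<sigma> \<kappa> p q x0 \<beta> 0 = \<lparr>point = x0, grad = G x0, dir = - G x0, evals = 0\<rparr>"
| "ncg f G \<eta> \<theta> \<sigma> \<kappa> p q x0 \<beta> (Suc k) =
     ncg_step f G \<eta> \<theta> \<sigma> \<kappa> p q (\<beta> (Suc k)) (ncg f G \<eta> \<theta> \<sigma> \<kappa> p q x0 \<beta> k)"

definition c_R :: "real \<Rightarrow> real \<Rightarrow> real \<Rightarrow> real" where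
  "c_R \<eta> \<theta> L = \<eta> * min 1 (2 * (1 - \<eta>) * \<theta> / L)"

definition c_N :: "real \<Rightarrow> real \<Rightarrow> real \<Rightarrow> real \<Rightarrow> real \<Rightarrow> real" where
  "c_N \<eta> \<theta> \<sigma> \<kappa> L = \<eta> * \<sigma> * min 1 (2 * (1 - \<eta>) * \<sigma> * \<theta> / (\<kappa>\<^sup>2 * L))"

end

theory Submission
  imports Defs
begin

text \<open>
  The method is a descent method whose search directions always satisfy one of two alternatives:
  either \<open>d = - g\<close>, or the restart test failed, and then \<open>- (g \<bullet> d) > \<sigma> \<parallel>g\<parallel>\<^sup>1\<^sup>+\<^sup>p\<close> and
  \<open>\<parallel>d\<parallel> < \<kappa> \<parallel>g\<parallel>\<^sup>q\<close>. In both cases the slope \<open>m = - (g \<bullet> d)\<close> is positive as long as \<open>g \<noteq> 0\<close>.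
  Since the gradient is \<open>L\<close>-Lipschitz, \<open>f\<close> lies below a quadratic with curvature \<open>L\<close>, so every
  step shorter than \<open>2 (1 - \<eta>) m / (L \<parallel>d\<parallel>\<^sup>2)\<close> is acceptable to the line search. Backtracking
  thus stops, with a step that is either \<open>1\<close> or at least \<open>\<theta>\<close> times this threshold, and one iteration
  decreases \<open>f\<close> by at least \<open>\<eta> min m (2 (1 - \<eta>) \<theta> m\<^sup>2 / (L \<parallel>d\<parallel>\<^sup>2))\<close>
  (lemma \<open>backtracking_decrease\<close>).

  While \<open>\<parallel>g\<parallel> > \<epsilon>\<close>, this decrease is at least \<open>c\<^sub>R \<epsilon>\<^sup>2\<close> in the first alternative, and in the second
  at least \<open>c\<^sub>N\<close> times the power of \<open>\<epsilon>\<close> with exponent \<open>max (1 + p) (2 (1 + p - q))\<close>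
  (lemmas \<open>decrease_steepest_descent\<close> and \<open>decrease_conjugate\<close>). Hence each
  iteration before the tolerance is met decreases \<open>f\<close> by at least the smaller of the two amounts,
  while all of them together cannot decrease it by more than \<open>f x0 - f_low\<close>. The number of
  iterations is therefore at most the larger of the two quotients, and so at most their sum.
\<close>

section \<open>Functions with a Lipschitz gradient\<close>

text \<open>
  With \<open>t *\<^sub>R d\<close> in place of \<open>d\<close>, the left side minus the right side is, up to the constant
  \<open>f x\<close>, the function \<open>h\<close> below. Its derivative is nonpositive for \<open>t \<ge> 0\<close>, because the gradient at
  \<open>x + t *\<^sub>R d\<close> differs from that at \<open>x\<close> by at most \<open>L t \<parallel>d\<parallel>\<close>.
\<close>

lemma lipschitz_gradient_upper_bound:
  fixes f :: "'a::real_inner \<Rightarrow> real"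
  assumes gradient: "\<And>x. GDERIV f x :> G x"
    and lipschitz: "L-lipschitz_on UNIV G"
  shows "f (x + d) \<le> f x + G x \<bullet> d + L / 2 * (norm d)\<^sup>2"
proof -
  define h where "h t = f (x + t *\<^sub>R d) - t * (G x \<bullet> d) - L / 2 * t\<^sup>2 * (norm d)\<^sup>2" for t
  have deriv: "(h has_real_derivative
      (G (x + t *\<^sub>R d) - G x) \<bullet> d - L * t * (norm d)\<^sup>2) (at t)" for t
  proof -
    have "((\<lambda>t. x + t *\<^sub>R d) has_derivative (\<lambda>u. u *\<^sub>R d)) (at t)"
      by (auto intro!: derivative_eq_intros)
    moreover have "(f has_derivative (\<lambda>u. u \<bullet> G (x + t *\<^sub>R d))) (at (x + t *\<^sub>R d))"
      using gradient by (simp add: gderiv_def)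
    ultimately have "((\<lambda>t. f (x + t *\<^sub>R d)) has_derivative
        (\<lambda>u. (u *\<^sub>R d) \<bullet> G (x + t *\<^sub>R d))) (at t)"
      by (rule has_derivative_compose)
    then have "((\<lambda>t. f (x + t *\<^sub>R d)) has_real_derivative G (x + t *\<^sub>R d) \<bullet> d) (at t)"
      by (simp add: has_field_derivative_def inner_commute mult_commute_abs)
    then show ?thesis
      unfolding h_def
      by (auto intro!: derivative_eq_intros simp: inner_diff_left)
  qed
  have "(G (x + t *\<^sub>R d) - G x) \<bullet> d - L * t * (norm d)\<^sup>2 \<le> 0" if "0 \<le> t" for t
  proof -
    have "(G (x + t *\<^sub>R d) - G x) \<bullet> d \<le> norm (G (x + t *\<^sub>R d) - G x) * norm d"
      by (rule norm_cauchy_schwarz)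
    also have "norm (G (x + t *\<^sub>R d) - G x) \<le> L * (t * norm d)"
      using lipschitz_onD[OF lipschitz, of "x + t *\<^sub>R d" x] that by (simp add: dist_norm)
    finally show ?thesis
      by (simp add: mult_right_mono power2_eq_square mult.assoc)
  qed
  then have "h 1 \<le> h 0"
    using deriv by (intro DERIV_nonpos_imp_nonincreasing[of 0 1 h]) fastforce+
  then show ?thesis
    by (simp add: h_def)
qed

section \<open>The backtracking line search\<close>

text \<open>
  Against the quadratic upper bound, the demanded fraction \<open>\<eta>\<close> of the linear decrease leaves the
  fraction \<open>1 - \<eta>\<close> to absorb the curvature term, which a short step keeps below it.
\<close>

lemma armijo_short_step:
  assumes gradient: "\<And>x. GDERIV f x :> G x"
    and lipschitz: "L-lipschitz_on UNIV G"
    and grad: "grad s = G (point s)"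
    and \<alpha>: "\<alpha> > 0"
    and short: "\<alpha> * (L * (norm (dir s))\<^sup>2) < 2 * (1 - \<eta>) * - (grad s \<bullet> dir s)"
  shows "armijo f \<eta> s \<alpha>"
proof -
  have "f (point s + \<alpha> *\<^sub>R dir s)
      \<le> f (point s) + \<alpha> * (grad s \<bullet> dir s) + \<alpha> * (\<alpha> * (L * (norm (dir s))\<^sup>2)) / 2"
    using lipschitz_gradient_upper_bound[OF gradient lipschitz, of "point s" "\<alpha> *\<^sub>R dir s"] grad
    by (simp add: power2_eq_square algebra_simps)
  moreover have "\<alpha> * (\<alpha> * (L * (norm (dir s))\<^sup>2)) < \<alpha> * (2 * (1 - \<eta>) * - (grad s \<bullet> dir s))"
    using short \<alpha> by (rule mult_strict_left_mono)
  ultimately show ?thesis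
    by (simp add: armijo_def algebra_simps)
qed

lemma armijo_backtrack_exists:
  assumes gradient: "\<And>x. GDERIV f x :> G x"
    and lipschitz: "L-lipschitz_on UNIV G"
    and grad: "grad s = G (point s)"
    and L: "L > 0" and \<eta>: "\<eta> < 1" and \<theta>: "0 < \<theta>" "\<theta> < 1"
    and descent: "grad s \<bullet> dir s < 0"
  shows "\<exists>j. armijo f \<eta> s (\<theta> ^ j)"
proof -
  have D: "L * (norm (dir s))\<^sup>2 > 0"
    using descent L by (intro mult_pos_pos) auto
  have "0 < 2 * (1 - \<eta>) * - (grad s \<bullet> dir s) / (L * (norm (dir s))\<^sup>2)"
    using descent \<eta> by (intro divide_pos_pos mult_pos_pos D) auto
  then obtain j where "\<theta> ^ j < 2 * (1 - \<eta>) * - (grad s \<bullet> dir s) / (L * (norm (dir s))\<^sup>2)"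
    using real_arch_pow_inv \<theta>(2) by blast
  then have "\<theta> ^ j * (L * (norm (dir s))\<^sup>2) < 2 * (1 - \<eta>) * - (grad s \<bullet> dir s)"
    using D by (simp only: pos_less_divide_eq)
  then show ?thesis
    using armijo_short_step[OF gradient lipschitz grad] \<theta>(1) by (metis zero_less_power)
qed

text \<open>
  Unless the unit step is accepted, the step \<open>\<alpha> / \<theta>\<close> was rejected just before \<open>\<alpha>\<close> was accepted,
  so it is not short in the sense of \<open>armijo_short_step\<close>.
\<close>

lemma backtrack_lower_bound:
  assumes gradient: "\<And>x. GDERIV f x :> G x"
    and lipschitz: "L-lipschitz_on UNIV G"
    and grad: "grad s = G (point s)"
    and L: "L > 0" and \<theta>: "0 < \<theta>"
    and descent: "grad s \<bullet> dir s < 0"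
  shows "min 1 (2 * (1 - \<eta>) * \<theta> * - (grad s \<bullet> dir s) / (L * (norm (dir s))\<^sup>2))
    \<le> backtrack f \<eta> \<theta> s"
proof (cases "LEAST j. armijo f \<eta> s (\<theta> ^ j)")
  case 0
  then show ?thesis
    by (simp add: backtrack_def)
next
  case (Suc i)
  have D: "L * (norm (dir s))\<^sup>2 > 0"
    using descent L by (intro mult_pos_pos) auto
  have "\<not> armijo f \<eta> s (\<theta> ^ i)"
    using Suc not_less_Least[of i "\<lambda>j. armijo f \<eta> s (\<theta> ^ j)"] by simp
  then have "2 * (1 - \<eta>) * - (grad s \<bullet> dir s) \<le> \<theta> ^ i * (L * (norm (dir s))\<^sup>2)"
    using armijo_short_step[OF gradient lipschitz grad] \<theta> by (meson not_less zero_less_power)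
  then have "\<theta> * (2 * (1 - \<eta>) * - (grad s \<bullet> dir s)) \<le> \<theta> * (\<theta> ^ i * (L * (norm (dir s))\<^sup>2))"
    using \<theta> by (intro mult_left_mono) auto
  then have "2 * (1 - \<eta>) * \<theta> * - (grad s \<bullet> dir s) / (L * (norm (dir s))\<^sup>2) \<le> \<theta> ^ Suc i"
    unfolding pos_divide_le_eq[OF D] by (simp add: algebra_simps)
  then show ?thesis
    using Suc by (simp add: backtrack_def)
qed

lemma backtracking_decrease:
  assumes gradient: "\<And>x. GDERIV f x :> G x"
    and lipschitz: "L-lipschitz_on UNIV G"
    and grad: "grad s = G (point s)"
    and L: "L > 0" and \<eta>: "0 < \<eta>" "\<eta> < 1" and \<theta>: "0 < \<theta>" "\<theta> < 1"
    and descent: "grad s \<bullet> dir s < 0"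
  defines "m \<equiv> - (grad s \<bullet> dir s)"
  shows "f (point s + backtrack f \<eta> \<theta> s *\<^sub>R dir s)
    \<le> f (point s) - \<eta> * min m (2 * (1 - \<eta>) * \<theta> * m\<^sup>2 / (L * (norm (dir s))\<^sup>2))"
proof -
  have m: "m > 0"
    using descent by (simp add: m_def)
  have "armijo f \<eta> s (backtrack f \<eta> \<theta> s)"
    unfolding backtrack_def
    using armijo_backtrack_exists[OF gradient lipschitz grad L \<eta>(2) \<theta> descent]
    by (rule LeastI_ex)
  then have "f (point s + backtrack f \<eta> \<theta> s *\<^sub>R dir s)
      \<le> f (point s) - \<eta> * (m * backtrack f \<eta> \<theta> s)"
    by (simp add: armijo_def m_def algebra_simps)
  moreover have "m * min 1 (2 * (1 - \<eta>) * \<theta> * m / (L * (norm (dir s))\<^sup>2))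
      \<le> m * backtrack f \<eta> \<theta> s"
    using backtrack_lower_bound[OF gradient lipschitz grad L \<theta>(1) descent, of \<eta>] m
    by (intro mult_left_mono) (auto simp: m_def)
  moreover have "m * min 1 (2 * (1 - \<eta>) * \<theta> * m / (L * (norm (dir s))\<^sup>2))
      = min m (2 * (1 - \<eta>) * \<theta> * m\<^sup>2 / (L * (norm (dir s))\<^sup>2))"
    using m by (simp add: min_mult_distrib_left power2_eq_square mult_ac)
  ultimately show ?thesis
    using \<eta>(1) by (smt (verit) mult_left_mono)
qed

section \<open>Decrease for the two kinds of search direction\<close>

text \<open>
  For \<open>d = - g\<close> the slope \<open>m\<close> equals \<open>\<parallel>d\<parallel>\<^sup>2\<close>, so both arguments of the minimum are multiples of
  \<open>\<parallel>g\<parallel>\<^sup>2\<close>.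
\<close>

lemma decrease_steepest_descent:
  fixes g :: "'a::real_inner"
  assumes \<eta>: "0 < \<eta>" "\<eta> < 1" and \<theta>: "0 < \<theta>" and L: "L > 0"
    and g: "norm g > \<epsilon>" and \<epsilon>: "\<epsilon> > 0"
    and m: "m = - (g \<bullet> - g)"
  shows "c_R \<eta> \<theta> L * \<epsilon> powr 2 \<le> \<eta> * min m (2 * (1 - \<eta>) * \<theta> * m\<^sup>2 / (L * (norm (- g))\<^sup>2))"
proof -
  have m': "m = (norm g)\<^sup>2"
    by (simp add: m power2_norm_eq_inner)
  have "m > 0"
    using g \<epsilon> by (auto simp: m')
  then have "min m (2 * (1 - \<eta>) * \<theta> * m\<^sup>2 / (L * (norm (- g))\<^sup>2))
      = m * min 1 (2 * (1 - \<eta>) * \<theta> / L)"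
    by (simp add: min_mult_distrib_left power2_eq_square[of m] mult_ac flip: m')
  moreover have "\<epsilon> powr 2 \<le> m"
    using g \<epsilon> by (simp add: m' power_mono)
  moreover have "c_R \<eta> \<theta> L \<ge> 0"
    using \<eta> \<theta> L by (simp add: c_R_def)
  ultimately show ?thesis
    using mult_left_mono[of "\<epsilon> powr 2" m "c_R \<eta> \<theta> L"] by (simp add: c_R_def mult_ac)
qed

text \<open>
  The two arguments of the minimum grow with \<open>m\<close> and do not grow with \<open>\<parallel>d\<parallel>\<close>, so the failed restart
  test bounds them by multiples of the powers of \<open>\<parallel>g\<parallel>\<close> with exponents \<open>1 + p\<close> and
  \<open>2 (1 + p - q)\<close>. These exponents are nonnegative, hence \<open>\<parallel>g\<parallel>\<close> may be replaced by \<open>\<epsilon>\<close>; and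
  as \<open>\<epsilon> < 1\<close>, the larger exponent gives a common lower bound.
\<close>

lemma decrease_conjugate:
  fixes g d :: "'a::real_inner"
  assumes \<eta>: "0 < \<eta>" "\<eta> < 1" and \<theta>: "0 < \<theta>" and L: "L > 0" and \<sigma>: "0 < \<sigma>" and \<kappa>: "0 < \<kappa>"
    and p: "0 \<le> p" and pq: "0 \<le> 1 + p - q"
    and g: "norm g > \<epsilon>" and \<epsilon>: "0 < \<epsilon>" "\<epsilon> < 1"
    and no_restart: "\<not> restart \<sigma> \<kappa> p q g d"
    and m: "m = - (g \<bullet> d)"
  shows "c_N \<eta> \<theta> \<sigma> \<kappa> L * \<epsilon> powr max (1 + p) (2 * (1 + p - q))
    \<le> \<eta> * min m (2 * (1 - \<eta>) * \<theta> * m\<^sup>2 / (L * (norm d)\<^sup>2))"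
proof -
  define e where "e = max (1 + p) (2 * (1 + p - q))"
  define n where "n = norm g"
  define A where "A = 2 * (1 - \<eta>) * \<sigma> * \<theta> / (\<kappa>\<^sup>2 * L)"
  have n: "n > 0" "\<epsilon> \<le> n"
    using g \<epsilon> by (auto simp: n_def)
  have m_gt: "\<sigma> * n powr (1 + p) < m" and d_lt: "norm d < \<kappa> * n powr q"
    using no_restart by (auto simp: restart_def m n_def)
  have m_pos: "0 < m"
    using m_gt \<sigma> n by (smt (verit) mult_pos_pos powr_gt_zero)
  then have d_pos: "0 < norm d"
    by (auto simp: m)
  have A: "0 < A"
    using \<eta> \<theta> L \<sigma> \<kappa> by (simp add: A_def)
  have power_bound: "\<epsilon> powr e \<le> n powr a" if "0 \<le> a" "a \<le> e" for a
  proof -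
    have "\<epsilon> powr e \<le> \<epsilon> powr a"
      using \<epsilon> that by (intro powr_mono') auto
    also have "\<dots> \<le> n powr a"
      using n \<epsilon> that by (intro powr_mono2) auto
    finally show ?thesis .
  qed
  have "\<sigma> * min 1 A * \<epsilon> powr e \<le> \<sigma> * 1 * n powr (1 + p)"
    using \<sigma> A p power_bound[of "1 + p"] by (intro mult_mono) (auto simp: e_def)
  then have first: "\<sigma> * min 1 A * \<epsilon> powr e \<le> m"
    using m_gt by simp
  have "\<sigma> * min 1 A * \<epsilon> powr e \<le> \<sigma> * A * n powr (2 * (1 + p - q))"
    using \<sigma> A pq power_bound[of "2 * (1 + p - q)"] by (intro mult_mono) (auto simp: e_def)
  also have "n powr (2 * (1 + p - q)) = (n powr (1 + p))\<^sup>2 / (n powr q)\<^sup>2"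
    using n by (simp add: powr_diff power_divide powr_powr flip: powr_numeral)
      (simp add: algebra_simps powr_diff)
  also have "\<sigma> * A * ((n powr (1 + p))\<^sup>2 / (n powr q)\<^sup>2)
      = 2 * (1 - \<eta>) * \<theta> * (\<sigma> * n powr (1 + p))\<^sup>2 / (L * (\<kappa> * n powr q)\<^sup>2)"
    by (simp add: A_def power2_eq_square mult_ac)
  also have "\<dots> \<le> 2 * (1 - \<eta>) * \<theta> * m\<^sup>2 / (L * (norm d)\<^sup>2)"
    using \<eta> \<theta> \<sigma> L m_gt d_lt d_pos by (intro frac_le mult_left_mono power_mono) auto
  finally have second:
    "\<sigma> * min 1 A * \<epsilon> powr e \<le> 2 * (1 - \<eta>) * \<theta> * m\<^sup>2 / (L * (norm d)\<^sup>2)" .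
  have "\<eta> * (\<sigma> * min 1 A * \<epsilon> powr e) \<le> \<eta> * min m (2 * (1 - \<eta>) * \<theta> * m\<^sup>2 / (L * (norm d)\<^sup>2))"
    using first second \<eta> by (intro mult_left_mono) auto
  then show ?thesis
    by (simp add: c_N_def A_def e_def mult.assoc)
qed

section \<open>The iterates\<close>

lemma ncg_grad: "grad (ncg f G \<eta> \<theta> \<sigma> \<kappa> p q x0 \<beta> k) = G (point (ncg f G \<eta> \<theta> \<sigma> \<kappa> p q x0 \<beta> k))"
  by (cases k) (simp_all add: ncg_step_def Let_def)

lemma ncg_evals: "evals (ncg f G \<eta> \<theta> \<sigma> \<kappa> p q x0 \<beta> k) = k"
  by (induction k) (simp_all add: ncg_step_def Let_def)

lemma ncg_point_Suc:
  "point (ncg f G \<eta> \<theta> \<sigma> \<kappa> p q x0 \<beta> (Suc k)) =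
     (let s = ncg f G \<eta> \<theta> \<sigma> \<kappa> p q x0 \<beta> k in point s + backtrack f \<eta> \<theta> s *\<^sub>R dir s)"
  by (simp add: ncg_step_def Let_def)

lemma ncg_dir_cases:
  "let s = ncg f G \<eta> \<theta> \<sigma> \<kappa> p q x0 \<beta> k
   in dir s = - grad s \<or> \<not> restart \<sigma> \<kappa> p q (grad s) (dir s)"
  by (cases k) (simp_all add: ncg_step_def Let_def)

lemma not_restart_imp_descent:
  assumes "\<sigma> > 0" "\<not> restart \<sigma> \<kappa> p q g d"
  shows "g \<bullet> d < 0"
  using assms by (smt (verit) restart_def mult_nonneg_nonneg minus_mult_left powr_ge_zero)

section \<open>The complexity bound\<close>

theorem theorem3p1:
  fixes f :: "real ^ 'n \<Rightarrow> real" and G :: "real ^ 'n \<Rightarrow> real ^ 'n"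
    and x0 :: "real ^ 'n" and \<beta> :: "nat \<Rightarrow> real"
    and L f_low \<epsilon> \<eta> \<theta> \<sigma> \<kappa> p q :: real
  assumes gradient: "\<And>x. GDERIV f x :> G x"
    and C1: "continuous_on UNIV G"
    and L_pos: "L > 0"
    and lipschitz: "L-lipschitz_on UNIV G"
    and bounded_below: "\<And>x. f x \<ge> f_low"
    and eps: "\<epsilon> \<in> {0<..<1}"
    and eta: "\<eta> \<in> {0<..<1}"
    and theta: "\<theta> \<in> {0<..<1}"
    and sigma: "\<sigma> \<in> {0<..1}"
    and kappa: "\<kappa> \<ge> 1"
    and p: "p \<ge> 0"
    and q: "q \<ge> 0"
    and pq: "1 + p - q \<ge> 0"
  defines "s \<equiv> ncg f G \<eta> \<theta> \<sigma> \<kappa> p q x0 \<beta>"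
    and "K_eps \<equiv>
      \<lfloor>(f x0 - f_low) / c_R \<eta> \<theta> L * \<epsilon> powr (- 2)
        + (f x0 - f_low) / c_N \<eta> \<theta> \<sigma> \<kappa> L * \<epsilon> powr (- max (1 + p) (2 * (1 + p - q)))\<rfloor>"
  shows "\<exists>K. norm (G (point (s K))) \<le> \<epsilon>
    \<and> (\<forall>k<K. \<not> norm (G (point (s k))) \<le> \<epsilon>)
    \<and> (\<forall>k<K. \<exists>j. armijo f \<eta> (s k) (\<theta> ^ j))
    \<and> int K \<le> K_eps
    \<and> int (evals (s K)) \<le> K_eps"
proof -
  define e where "e = max (1 + p) (2 * (1 + p - q))"
  define \<Delta> where "\<Delta> = f x0 - f_low"
  define \<delta>R where "\<delta>R = c_R \<eta> \<theta> L * \<epsilon> powr 2"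
  define \<delta>N where "\<delta>N = c_N \<eta> \<theta> \<sigma> \<kappa> L * \<epsilon> powr e"
  define \<delta> where "\<delta> = min \<delta>R \<delta>N"
  note ranges = eps eta theta sigma kappa L_pos
  have pos: "\<delta>R > 0" "\<delta>N > 0"
    using ranges by (auto simp: \<delta>R_def \<delta>N_def c_R_def c_N_def min_def intro!: mult_pos_pos divide_pos_pos)
  have \<delta>_pos: "\<delta> > 0"
    using pos by (simp add: \<delta>_def)
  have \<Delta>_nonneg: "\<Delta> \<ge> 0"
    using bounded_below by (simp add: \<Delta>_def)
  have grad_s: "grad (s k) = G (point (s k))" for k
    unfolding s_def by (rule ncg_grad)
  have dir_cases: "dir (s k) = - grad (s k) \<or> \<not> restart \<sigma> \<kappa> p q (grad (s k)) (dir (s k))" for k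
    using ncg_dir_cases unfolding s_def Let_def .
  have descent: "grad (s k) \<bullet> dir (s k) < 0" if "norm (G (point (s k))) > \<epsilon>" for k
    using dir_cases[of k]
  proof
    assume "dir (s k) = - grad (s k)"
    moreover have "grad (s k) \<noteq> 0"
      using that eps grad_s by auto
    ultimately show ?thesis
      by simp
  next
    assume "\<not> restart \<sigma> \<kappa> p q (grad (s k)) (dir (s k))"
    then show ?thesis
      using sigma not_restart_imp_descent by auto
  qed
  have step: "f (point (s (Suc k))) \<le> f (point (s k)) - \<delta>" if large: "norm (G (point (s k))) > \<epsilon>" for k
  proof -
    define m where "m = - (grad (s k) \<bullet> dir (s k))"
    have "f (point (s (Suc k))) \<le> f (point (s k))
        - \<eta> * min m (2 * (1 - \<eta>) * \<theta> * m\<^sup>2 / (L * (norm (dir (s k)))\<^sup>2))"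
      using backtracking_decrease[OF gradient lipschitz grad_s L_pos _ _ _ _ descent[OF large], of \<eta> \<theta>]
        ranges ncg_point_Suc[of f G \<eta> \<theta> \<sigma> \<kappa> p q x0 \<beta> k]
      by (simp add: m_def Let_def flip: s_def)
    moreover have "\<delta> \<le> \<eta> * min m (2 * (1 - \<eta>) * \<theta> * m\<^sup>2 / (L * (norm (dir (s k)))\<^sup>2))"
      using dir_cases[of k]
    proof
      assume "dir (s k) = - grad (s k)"
      then have "\<delta>R \<le> \<eta> * min m (2 * (1 - \<eta>) * \<theta> * m\<^sup>2 / (L * (norm (dir (s k)))\<^sup>2))"
        using decrease_steepest_descent[of \<eta> \<theta> L \<epsilon> "grad (s k)" m] ranges large
        by (simp only: m_def \<delta>R_def grad_s) simp
      then show ?thesis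
        by (simp add: \<delta>_def)
    next
      assume "\<not> restart \<sigma> \<kappa> p q (grad (s k)) (dir (s k))"
      then have "\<delta>N \<le> \<eta> * min m (2 * (1 - \<eta>) * \<theta> * m\<^sup>2 / (L * (norm (dir (s k)))\<^sup>2))"
        unfolding \<delta>N_def e_def
        using ranges p pq large by (intro decrease_conjugate) (auto simp: m_def grad_s)
      then show ?thesis
        by (simp add: \<delta>_def)
    qed
    ultimately show ?thesis
      by simp
  qed
  have total: "real k * \<delta> \<le> \<Delta>" if "\<forall>i<k. norm (G (point (s i))) > \<epsilon>" for k
  proof -
    have "f (point (s k)) \<le> f x0 - real k * \<delta>"
      using that
    proof (induction k)
      case 0
      show ?case
        by (simp add: s_def)
    next
      case (Suc k)
      then have "f (point (s k)) \<le> f x0 - real k * \<delta>" "f (point (s (Suc k))) \<le> f (point (s k)) - \<delta>"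
        using step by auto
      then show ?case
        by (simp add: algebra_simps)
    qed
    then show ?thesis
      using bounded_below[of "point (s k)"] by (simp add: \<Delta>_def)
  qed
  have bound: "int k \<le> K_eps" if "\<forall>i<k. norm (G (point (s i))) > \<epsilon>" for k
  proof -
    have "real k \<le> \<Delta> / \<delta>"
      using total[OF that] \<delta>_pos by (simp add: pos_le_divide_eq)
    also have "\<dots> \<le> \<Delta> / \<delta>R + \<Delta> / \<delta>N"
      using pos \<Delta>_nonneg by (simp add: \<delta>_def min_def)
    also have "\<dots> = (f x0 - f_low) / c_R \<eta> \<theta> L * \<epsilon> powr (- 2)
        + (f x0 - f_low) / c_N \<eta> \<theta> \<sigma> \<kappa> L * \<epsilon> powr (- e)"
      by (simp only: \<Delta>_def \<delta>R_def \<delta>N_def powr_minus_divide) simp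
    finally show ?thesis
      by (simp only: K_eps_def e_def le_floor_iff of_int_of_nat_eq)
  qed
  have reached: "\<exists>k. norm (G (point (s k))) \<le> \<epsilon>"
  proof (rule ccontr)
    assume "\<not> ?thesis"
    then have "\<forall>i<Suc (nat K_eps). norm (G (point (s i))) > \<epsilon>"
      by (meson not_le)
    from bound[OF this] show False
      by linarith
  qed
  define K where "K = (LEAST k. norm (G (point (s k))) \<le> \<epsilon>)"
  have "norm (G (point (s K))) \<le> \<epsilon>"
    unfolding K_def using reached by (rule LeastI_ex)
  moreover have before: "\<forall>k<K. norm (G (point (s k))) > \<epsilon>"
    unfolding K_def using not_less_Least by (metis not_le)
  moreover have "\<exists>j. armijo f \<eta> (s k) (\<theta> ^ j)" if "k < K" for k
    using armijo_backtrack_exists[OF gradient lipschitz grad_s L_pos] descent before that ranges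
    by auto
  moreover have "evals (s K) = K"
    unfolding s_def by (rule ncg_evals)
  ultimately show ?thesis
    using bound[OF before] by (intro exI[of _ K]) (auto simp: not_le)
qed

end
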